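(* For Non-Risky Stochastic Knapsack and $\varepsilon\in(0,1)$, with $k=\tilde O(1/\varepsilon)$ adaptive queries the $k$-$n$ semi-adaptivity gap $\sup_I \mathrm{ADAPT}(I)/A_k(I)$ is at most $3+O(\varepsilon)$.
   Context: Stochastic Knapsack: an instance $I$ consists of $n$ items; item $i$ has a deterministic value $v_i\ge 0$ and a random nonnegative size $S_i$ drawn from a known distribution, independently across items. The knapsack capacity is $1$. A policy inserts items one at a time (each at most once) and may stop at any time; execution ends when the policy stops or at the first overflow, i.e., when the total realized size of inserted items exceeds $1$. In Non-Risky Stochastic Knapsack the policy receives the sum of the values of the inserted items, except that the overflowing item contributes no value. An adaptive query is a step at which the policy observes the current total realized size of the inserted items; a policy is $k$-semi-adaptive if it makes at most $k$ adaptive queries (between queries it inserts items non-adaptively). $A_k(I)$ is the maximum expected value over $k$-semi-adaptive policies, and $\mathrm{ADAPT}(I)=A_n(I)$ is the optimal fully adaptive expected value. $\tilde O$ hides polylogarithmic factors. *)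

theory Defs
  imports "HOL-Probability.Probability"
begin

record knapsack =
  num_items :: nat
  item_value :: "nat \<Rightarrow> real"
  item_size :: "nat \<Rightarrow> real measure"

definition knapsack_instances :: "knapsack set" where
  "knapsack_instances =
     {I. \<forall>i < num_items I.
        0 \<le> item_value I i \<and>
        prob_space (item_size I i) \<and>
        sets (item_size I i) = sets borel \<and>
        (AE x in item_size I i. 0 \<le> x)}"

text \<open>The joint law of the independent sizes of all items.\<close>

definition size_space :: "knapsack \<Rightarrow> (nat \<Rightarrow> real) measure" where
  "size_space I = PiM {..<num_items I} (item_size I)"

text \<open>
  A policy is a decision tree. Only \<open>Query\<close> reveals information: its argument is the current
  total realized size, and since the tree continues below the answer, later decisions may depend
  on all earlier answers. Decisions between two queries are non-adaptive.
\<close>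

datatype policy = Stop | Insert nat policy | Query "real \<Rightarrow> policy"

text \<open>
  \<open>semi_adaptive A k p\<close>: the policy \<open>p\<close> inserts only items of \<open>A\<close>, each at most once, and makes
  at most \<open>k\<close> queries along every branch.
\<close>

inductive semi_adaptive :: "nat set \<Rightarrow> nat \<Rightarrow> policy \<Rightarrow> bool" where
  "semi_adaptive A k Stop"
| "i \<in> A \<Longrightarrow> semi_adaptive (A - {i}) k p \<Longrightarrow> semi_adaptive A k (Insert i p)"
| "(\<And>x. semi_adaptive A k (f x)) \<Longrightarrow> semi_adaptive A (Suc k) (Query f)"

text \<open>
  Value collected by a policy when the items have values \<open>v\<close> and realized sizes \<open>X\<close> and the
  total size inserted so far is \<open>s\<close>. The first overflow ends the execution; the overflowing item
  contributes nothing, while everything collected before it is kept.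
\<close>

primrec reward :: "(nat \<Rightarrow> real) \<Rightarrow> (nat \<Rightarrow> real) \<Rightarrow> policy \<Rightarrow> real \<Rightarrow> real" where
  "reward v X Stop s = 0"
| "reward v X (Insert i p) s = (if s + X i \<le> 1 then v i + reward v X p (s + X i) else 0)"
| "reward v X (Query f) s = reward v X (f s) s"

text \<open>
  Branching on a query is arbitrary in the datatype, so the policies are restricted to those whose
  collected value is a random variable.
\<close>

definition policies :: "knapsack \<Rightarrow> nat \<Rightarrow> policy set" where
  "policies I k =
     {p. semi_adaptive {..<num_items I} k p \<and>
         (\<lambda>X. reward (item_value I) X p 0) \<in> borel_measurable (size_space I)}"

definition expected_value :: "knapsack \<Rightarrow> policy \<Rightarrow> ennreal" where
  "expected_value I p = (\<integral>\<^sup>+ X. ennreal (reward (item_value I) X p 0) \<partial>size_space I)"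

definition opt_semi_adaptive :: "nat \<Rightarrow> knapsack \<Rightarrow> ennreal" where
  "opt_semi_adaptive k I = (SUP p \<in> policies I k. expected_value I p)"

definition opt_adaptive :: "knapsack \<Rightarrow> ennreal" where
  "opt_adaptive I = opt_semi_adaptive (num_items I) I"

text \<open>
  In \<^typ>\<open>ennreal\<close>, \<open>a / 0\<close> is \<open>\<infinity>\<close> for \<open>a > 0\<close>, and \<open>0 / 0 = 0\<close>, so that only instances on which
  every policy has value zero are disregarded.
\<close>

definition semi_adaptivity_gap :: "nat \<Rightarrow> ennreal" where
  "semi_adaptivity_gap k =
     (SUP I \<in> knapsack_instances. opt_adaptive I / opt_semi_adaptive k I)"

end

theory Submission
  imports Defs
begin

text \<open>
  Write \<open>mean_size i\<close> for the mean of the truncated size \<open>min S\<^sub>i 1\<close> and call an item large if this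
  is at least \<open>\<delta> = \<epsilon> / 2\<close>. The adaptive optimum is at most the sum of the adaptive optima over the
  large and over the small items.

  For large items, \<open>E (exp (- S\<^sub>i); S\<^sub>i \<le> 1) \<le> 1 - \<delta> / 2\<close>, so by a Chernoff bound every policy survives
  \<open>k\<close> insertions with probability at most \<open>exp 1 * (1 - \<delta> / 2) ^ k\<close>. This is at most \<open>\<delta>\<close> for
  \<open>k = O(log (1 / \<epsilon>) / \<epsilon>)\<close>, and querying after each of the first \<open>k\<close> insertions therefore loses
  only a fraction \<open>\<delta>\<close> of the optimum.

  For small items, insert non-adaptively in order of decreasing ratio \<open>v\<^sub>i / mean_size i\<close>. For a set
  \<open>J\<close> of items let \<open>T\<close> be the sum of the truncated sizes over \<open>J\<close>. No policy attempts
  items of \<open>J\<close> of expected total mean size more than \<open>E (min T 2)\<close>, and if \<open>J\<close> is a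
  prefix of the list, the list attempts at least \<open>E (min T 1)\<close>. Since \<open>v\<close> is a conic combination
  of the functions \<open>mean_size\<close> restricted to prefixes, the list collects at least half of the
  optimum if the overflowing item is also paid for. That payment is at most a fraction \<open>\<delta>\<close>,
  because small items have mean at most \<open>\<delta>\<close>.
\<close>

section \<open>Elementary facts on policies, rewards and real inequalities\<close>

lemma semi_adaptive_mono:
  assumes "semi_adaptive A k p" "A \<subseteq> A'" "k \<le> k'"
  shows "semi_adaptive A' k' p"
  using assms
proof (induction arbitrary: A' k' rule: semi_adaptive.induct)
  case (1 A k)
  then show ?case by (simp add: semi_adaptive.intros)
next
  case (2 i A k p)
  have "semi_adaptive (A' - {i}) k' p" by (rule "2.IH") (use 2 in auto)
  then show ?case using 2 by (auto intro: semi_adaptive.intros)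
next
  case (3 A k f)
  then obtain j where "k' = Suc j" "k \<le> j" by (cases k') auto
  then show ?case using 3 by (auto intro: semi_adaptive.intros)
qed

lemma reward_cong:
  assumes "semi_adaptive A k p" "\<And>i. i \<in> A \<Longrightarrow> X i = Y i"
  shows "reward v X p s = reward v Y p s"
  using assms by (induction arbitrary: s rule: semi_adaptive.induct) auto

lemma reward_nonneg:
  assumes "semi_adaptive A k p" "\<And>i. i \<in> A \<Longrightarrow> 0 \<le> v i"
  shows "0 \<le> reward v X p s"
  using assms by (induction arbitrary: s rule: semi_adaptive.induct) auto

text \<open>Linearises the Chernoff weight on [0, 1], so that the expected discount of one insertion
  can be read off from the mean truncated size in \<open>step_exp_le\<close>.\<close>

lemma exp_minus_le:
  fixes y :: real
  assumes "0 \<le> y" "y \<le> 1"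
  shows "exp (- y) \<le> 1 - y / 2"
proof -
  have "exp (- y) \<le> 1 / (1 + y)"
    using assms exp_ge_add_one_self[of y] by (simp add: exp_minus field_simps)
  also have "\<dots> \<le> 1 - y / 2"
  proof -
    have "0 \<le> y * (1 - y)" using assms by simp
    then have "1 \<le> (1 - y / 2) * (1 + y)" by (simp add: algebra_simps)
    then show ?thesis using assms by (simp add: pos_divide_le_eq)
  qed
  finally show ?thesis .
qed

text \<open>Absorbs a loss that is a fraction of the quantity being bounded. Finiteness of
  \<open>x\<close> makes the subtraction legitimate: for \<delta> > 0, an infinite \<open>x\<close>
  satisfies the inequality with every \<open>a\<close>.\<close>

lemma le_of_le_add_fraction:
  fixes x a :: ennreal
  assumes "x \<le> a + ennreal \<delta> * x" "x < \<top>" "0 \<le> \<delta>" "\<delta> < 1"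
  shows "x \<le> ennreal (1 / (1 - \<delta>)) * a"
proof (cases a)
  case top
  then show ?thesis using assms by (simp add: ennreal_mult_top)
next
  case (real r)
  obtain y where y: "x = ennreal y" "0 \<le> y" using assms(2) by (cases x) auto
  have "y \<le> r + \<delta> * y"
    using assms real y by (simp add: ennreal_mult[symmetric] ennreal_plus[symmetric] del: ennreal_plus)
  then have "y \<le> 1 / (1 - \<delta>) * r" using assms by (simp add: field_simps)
  then show ?thesis using real y assms by (simp add: ennreal_mult[symmetric] ennreal_leI)
qed

section \<open>The transition operator of a single insertion\<close>

text \<open>Every index carries a distribution, item or not, because
  \<open>product_sigma_finite\<close> asks this of the whole family. An instance is later padded to
  fit.\<close>

locale item_sizes =
  fixes M :: "nat \<Rightarrow> real measure"
  assumes prob_size: "prob_space (M i)"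
    and sets_size [measurable_cong]: "sets (M i) = sets borel"
    and size_nonneg: "AE x in M i. 0 \<le> x"
begin

lemma space_size [simp]: "space (M i) = UNIV"
  using sets_eq_imp_space_eq[OF sets_size] by simp

lemma sigma_finite_size: "sigma_finite_measure (M i)"
  by (rule prob_space_imp_sigma_finite[OF prob_size])

sublocale product_sigma_finite M
  by (rule product_sigma_finite.intro) (rule sigma_finite_size)

lemma emeasure_size [simp]: "emeasure (M i) UNIV = 1"
  using prob_space.emeasure_space_1[OF prob_size, of i] by simp

text \<open>The Markov operator of the used capacity, killed at the first overflow. All value
  recursions below are built from it.\<close>

definition step :: "nat \<Rightarrow> (real \<Rightarrow> ennreal) \<Rightarrow> real \<Rightarrow> ennreal" where
  "step i f s = (\<integral>\<^sup>+ x. (if s + x \<le> 1 then f (s + x) else 0) \<partial>M i)"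

lemma measurable_step [measurable]:
  assumes [measurable]: "f \<in> borel_measurable borel"
  shows "step i f \<in> borel_measurable borel"
proof -
  interpret sigma_finite_measure "M i" by (rule sigma_finite_size)
  have "(\<lambda>s. \<integral>\<^sup>+ x. (if s + x \<le> 1 then f (s + x) else 0) \<partial>M i) \<in> borel_measurable borel"
    by measurable
  then show ?thesis by (simp add: step_def[abs_def])
qed

lemma step_mono:
  assumes "\<And>t. s \<le> t \<Longrightarrow> t \<le> 1 \<Longrightarrow> f t \<le> g t"
  shows "step i f s \<le> step i g s"
  unfolding step_def
  by (rule nn_integral_mono_AE) (use size_nonneg[of i] assms in \<open>auto elim!: eventually_mono\<close>)

lemma step_antimono:
  assumes "antimono f" "s \<le> t"
  shows "step i f t \<le> step i f s"
  unfolding step_def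
  using assms by (intro nn_integral_mono) (auto intro: antimonoD[OF assms(1)])

lemma step_add:
  assumes [measurable]: "f \<in> borel_measurable borel" "g \<in> borel_measurable borel"
  shows "step i (\<lambda>t. f t + g t) s = step i f s + step i g s"
  unfolding step_def by (subst nn_integral_add[symmetric]) (auto intro!: nn_integral_cong)

lemma step_cmult:
  assumes [measurable]: "f \<in> borel_measurable borel"
  shows "step i (\<lambda>t. c * f t) s = c * step i f s"
  unfolding step_def by (subst nn_integral_cmult[symmetric]) (auto intro!: nn_integral_cong)

lemma step_const_le: "step i (\<lambda>_. c) s \<le> c"
proof -
  have "step i (\<lambda>_. c) s \<le> (\<integral>\<^sup>+ x. c \<partial>M i)"
    unfolding step_def by (intro nn_integral_mono) auto
  then show ?thesis by simp
qed

lemma step_zero [simp]: "step i (\<lambda>_. 0) s = 0"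
  using step_const_le[of i 0 s] by simp

lemma step_le_bound:
  assumes "\<And>t. s \<le> t \<Longrightarrow> t \<le> 1 \<Longrightarrow> f t \<le> c"
  shows "step i f s \<le> c"
  by (rule order_trans[OF step_mono step_const_le]) (rule assms)

section \<open>Value recursions of optimal policies and of fixed lists\<close>

definition mean_size :: "nat \<Rightarrow> ennreal" where
  "mean_size i = (\<integral>\<^sup>+ x. ennreal (min x 1) \<partial>M i)"

text \<open>
  The optimal value when at most \<open>m\<close> items of \<open>B\<close> may still be inserted and the capacity \<open>s\<close> is in
  use. The variants named \<open>attempt\<close> also pay for the overflowing item.
\<close>

primrec opt :: "(nat \<Rightarrow> ennreal) \<Rightarrow> nat \<Rightarrow> nat set \<Rightarrow> real \<Rightarrow> ennreal" where
  "opt u 0 B s = 0"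
| "opt u (Suc m) B s = (SUP i\<in>B. step i (\<lambda>t. u i + opt u m (B - {i}) t) s)"

primrec opt_attempt :: "(nat \<Rightarrow> ennreal) \<Rightarrow> nat \<Rightarrow> nat set \<Rightarrow> real \<Rightarrow> ennreal" where
  "opt_attempt u 0 B s = 0"
| "opt_attempt u (Suc m) B s = (SUP i\<in>B. u i + step i (opt_attempt u m (B - {i})) s)"

primrec list_value :: "(nat \<Rightarrow> ennreal) \<Rightarrow> nat list \<Rightarrow> real \<Rightarrow> ennreal" where
  "list_value u [] s = 0"
| "list_value u (i # l) s = step i (\<lambda>t. u i + list_value u l t) s"

primrec list_attempt :: "(nat \<Rightarrow> ennreal) \<Rightarrow> nat list \<Rightarrow> real \<Rightarrow> ennreal" where
  "list_attempt u [] s = 0"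
| "list_attempt u (i # l) s = u i + step i (list_attempt u l) s"

lemma measurable_opt [measurable]: "opt u m B \<in> borel_measurable borel"
proof (induction m arbitrary: B)
  case 0
  then show ?case by (simp add: opt.simps(1)[abs_def])
next
  case (Suc m)
  note [measurable] = Suc
  have "(\<lambda>s. SUP i\<in>B. step i (\<lambda>t. u i + opt u m (B - {i}) t) s) \<in> borel_measurable borel"
    by (intro borel_measurable_SUP) (auto intro: countable_subset)
  then show ?case by (simp add: opt.simps(2)[abs_def])
qed

lemma measurable_opt_attempt [measurable]: "opt_attempt u m B \<in> borel_measurable borel"
proof (induction m arbitrary: B)
  case 0
  then show ?case by (simp add: opt_attempt.simps(1)[abs_def])
next
  case (Suc m)
  note [measurable] = Suc
  have "(\<lambda>s. SUP i\<in>B. u i + step i (opt_attempt u m (B - {i})) s) \<in> borel_measurable borel"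
    by (intro borel_measurable_SUP) auto
  then show ?case by (simp add: opt_attempt.simps(2)[abs_def])
qed

lemma measurable_list_value [measurable]: "list_value u l \<in> borel_measurable borel"
proof (induction l)
  case Nil
  then show ?case by (simp add: list_value.simps(1)[abs_def])
next
  case (Cons i l)
  note [measurable] = Cons
  have "step i (\<lambda>t. u i + list_value u l t) \<in> borel_measurable borel" by measurable
  then show ?case by (simp add: list_value.simps(2)[abs_def])
qed

lemma measurable_list_attempt [measurable]: "list_attempt u l \<in> borel_measurable borel"
proof (induction l)
  case Nil
  then show ?case by (simp add: list_attempt.simps(1)[abs_def])
next
  case (Cons i l)
  note [measurable] = Cons
  have "(\<lambda>s. u i + step i (list_attempt u l) s) \<in> borel_measurable borel" by measurable
  then show ?case by (simp add: list_attempt.simps(2)[abs_def])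
qed

text \<open>With more capacity in use, each insertion overflows on a larger event and otherwise
  continues from a worse state.\<close>

lemma antimono_opt: "antimono (opt u m B)"
proof (induction m arbitrary: B)
  case 0
  then show ?case by (simp add: antimono_def)
next
  case (Suc m)
  have "antimono (\<lambda>t. u i + opt u m (B - {i}) t)" for i
    using Suc[of "B - {i}"] by (auto simp: antimono_def intro: add_left_mono)
  then show ?case
    by (intro antimonoI) (auto intro!: SUP_mono' step_antimono)
qed

lemma opt_mono:
  assumes "m \<le> m'" "B \<subseteq> B'"
  shows "opt u m B s \<le> opt u m' B' s"
  using assms
proof (induction m arbitrary: m' B B' s)
  case 0
  then show ?case by simp
next
  case (Suc m)
  then obtain n where n: "m' = Suc n" "m \<le> n" by (cases m') auto
  have "opt u m (B - {i}) t \<le> opt u n (B' - {i}) t" for i t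
    by (rule Suc.IH) (use Suc n in auto)
  then show ?case
    unfolding n opt.simps by (intro SUP_subset_mono step_mono add_left_mono) (use Suc in auto)
qed

lemma opt_le_opt_attempt: "opt u m B s \<le> opt_attempt u m B s"
proof (induction m arbitrary: B s)
  case 0
  then show ?case by simp
next
  case (Suc m)
  have "step i (\<lambda>t. u i + opt u m (B - {i}) t) s \<le> u i + step i (opt_attempt u m (B - {i})) s" for i
    by (subst step_add) (auto intro!: add_mono step_const_le step_mono Suc)
  then show ?case by (auto intro!: SUP_mono')
qed

lemma opt_attempt_le_sum:
  assumes "finite B"
  shows "opt_attempt u m B s \<le> sum u B"
  using assms
proof (induction m arbitrary: B s)
  case 0
  then show ?case by simp
next
  case (Suc m)
  show ?case
    unfolding opt_attempt.simps
  proof (rule SUP_least)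
    fix i assume i: "i \<in> B"
    have "step i (opt_attempt u m (B - {i})) s \<le> sum u (B - {i})"
      by (intro step_le_bound Suc.IH) (use Suc.prems in auto)
    then show "u i + step i (opt_attempt u m (B - {i})) s \<le> sum u B"
      using sum.remove[OF Suc.prems i, of u] by (simp add: add_left_mono)
  qed
qed


text \<open>A single policy has to serve both value functions at once, which separate optima need
  not. With \<open>opt_attempt_cmult\<close>, an upper bound on the optimum thus extends from
  generators to the cone of value functions they span.\<close>

lemma opt_attempt_add:
  "opt_attempt (\<lambda>i. u i + w i) m B s \<le> opt_attempt u m B s + opt_attempt w m B s"
proof (induction m arbitrary: B s)
  case 0
  then show ?case by simp
next
  case (Suc m)
  show ?case
    unfolding opt_attempt.simps(2)[of "\<lambda>i. u i + w i"]
  proof (rule SUP_least)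
    fix i assume i: "i \<in> B"
    have "step i (opt_attempt (\<lambda>i. u i + w i) m (B - {i})) s
        \<le> step i (\<lambda>t. opt_attempt u m (B - {i}) t + opt_attempt w m (B - {i}) t) s"
      by (intro step_mono Suc)
    also have "\<dots> = step i (opt_attempt u m (B - {i})) s + step i (opt_attempt w m (B - {i})) s"
      by (rule step_add) auto
    finally have "u i + w i + step i (opt_attempt (\<lambda>i. u i + w i) m (B - {i})) s
        \<le> (u i + step i (opt_attempt u m (B - {i})) s) + (w i + step i (opt_attempt w m (B - {i})) s)"
      by (metis (no_types, lifting) add.assoc add.left_commute add_left_mono)
    also have "\<dots> \<le> opt_attempt u (Suc m) B s + opt_attempt w (Suc m) B s"
      unfolding opt_attempt.simps by (intro add_mono SUP_upper i)
    finally show "u i + w i + step i (opt_attempt (\<lambda>i. u i + w i) m (B - {i})) s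
        \<le> opt_attempt u (Suc m) B s + opt_attempt w (Suc m) B s" .
  qed
qed

lemma opt_attempt_cmult:
  "opt_attempt (\<lambda>i. c * u i) m B s \<le> c * opt_attempt u m B s"
proof (induction m arbitrary: B s)
  case 0
  then show ?case by simp
next
  case (Suc m)
  show ?case
    unfolding opt_attempt.simps(2)[of "\<lambda>i. c * u i"]
  proof (rule SUP_least)
    fix i assume i: "i \<in> B"
    have "step i (opt_attempt (\<lambda>i. c * u i) m (B - {i})) s \<le> step i (\<lambda>t. c * opt_attempt u m (B - {i}) t) s"
      by (intro step_mono Suc)
    also have "\<dots> = c * step i (opt_attempt u m (B - {i})) s"
      by (rule step_cmult) auto
    finally have "c * u i + step i (opt_attempt (\<lambda>i. c * u i) m (B - {i})) s
        \<le> c * (u i + step i (opt_attempt u m (B - {i})) s)"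
      by (simp add: distrib_left add_left_mono)
    also have "\<dots> \<le> c * opt_attempt u (Suc m) B s"
      unfolding opt_attempt.simps by (intro mult_left_mono SUP_upper i) auto
    finally show "c * u i + step i (opt_attempt (\<lambda>i. c * u i) m (B - {i})) s
        \<le> c * opt_attempt u (Suc m) B s" .
  qed
qed

lemma opt_attempt_cong:
  assumes "\<And>i. i \<in> B \<Longrightarrow> u i = w i"
  shows "opt_attempt u m B s = opt_attempt w m B s"
  using assms
proof (induction m arbitrary: B s)
  case 0
  then show ?case by simp
next
  case (Suc m)
  have "opt_attempt u m (B - {i}) = opt_attempt w m (B - {i})" for i
    by (rule ext, rule Suc.IH) (use Suc.prems in auto)
  then show ?case using Suc.prems by simp
qed

text \<open>A fixed list makes no choice, so additivity is exact here. Equality is needed because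
  list values occur on both sides of the inequalities in \<open>greedy_bounds\<close>.\<close>

lemma list_value_add:
  "list_value (\<lambda>i. u i + w i) l s = list_value u l s + list_value w l s"
proof (induction l arbitrary: s)
  case (Cons i l)
  have "list_value (\<lambda>i. u i + w i) (i # l) s
      = step i (\<lambda>t. (u i + list_value u l t) + (w i + list_value w l t)) s"
    by (simp add: Cons ac_simps)
  also have "\<dots> = list_value u (i # l) s + list_value w (i # l) s"
    by (subst step_add) auto
  finally show ?case .
qed simp

lemma list_value_cmult: "list_value (\<lambda>i. c * u i) l s = c * list_value u l s"
proof (induction l arbitrary: s)
  case (Cons i l)
  have "list_value (\<lambda>i. c * u i) (i # l) s = step i (\<lambda>t. c * (u i + list_value u l t)) s"
    by (simp add: Cons distrib_left)
  also have "\<dots> = c * list_value u (i # l) s"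
    by (subst step_cmult) auto
  finally show ?case .
qed simp

lemma list_value_cong:
  assumes "\<And>i. i \<in> set l \<Longrightarrow> u i = w i"
  shows "list_value u l = list_value w l"
  using assms by (induction l) (auto intro!: ext)

lemma list_attempt_add:
  "list_attempt (\<lambda>i. u i + w i) l s = list_attempt u l s + list_attempt w l s"
proof (induction l arbitrary: s)
  case (Cons i l)
  have "list_attempt (\<lambda>i. u i + w i) (i # l) s
      = (u i + w i) + step i (\<lambda>t. list_attempt u l t + list_attempt w l t) s"
    by (simp add: Cons[THEN ext])
  also have "\<dots> = list_attempt u (i # l) s + list_attempt w (i # l) s"
    by (subst step_add) (auto simp: ac_simps)
  finally show ?case .
qed simp

lemma list_attempt_cmult: "list_attempt (\<lambda>i. c * u i) l s = c * list_attempt u l s"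
proof (induction l arbitrary: s)
  case (Cons i l)
  have "list_attempt (\<lambda>i. c * u i) (i # l) s = c * u i + step i (\<lambda>t. c * list_attempt u l t) s"
    by (simp add: Cons[THEN ext])
  also have "\<dots> = c * list_attempt u (i # l) s"
    by (subst step_cmult) (auto simp: distrib_left)
  finally show ?case .
qed simp

lemma list_attempt_cong:
  assumes "\<And>i. i \<in> set l \<Longrightarrow> u i = w i"
  shows "list_attempt u l = list_attempt w l"
  using assms by (induction l) (auto intro!: ext)

lemma list_value_zero:
  assumes "\<And>i. i \<in> set l \<Longrightarrow> u i = 0"
  shows "list_value u l = (\<lambda>_. 0)"
  using assms by (induction l) auto

lemma list_attempt_zero:
  assumes "\<And>i. i \<in> set l \<Longrightarrow> u i = 0"
  shows "list_attempt u l = (\<lambda>_. 0)"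
  using assms by (induction l) auto

lemma list_value_append:
  assumes "\<And>i. i \<in> set l' \<Longrightarrow> u i = 0"
  shows "list_value u (l @ l') = list_value u l"
  by (induction l) (auto simp: list_value_zero[OF assms] intro!: ext)

lemma list_attempt_append:
  assumes "\<And>i. i \<in> set l' \<Longrightarrow> u i = 0"
  shows "list_attempt u (l @ l') = list_attempt u l"
  by (induction l) (auto simp: list_attempt_zero[OF assms] intro!: ext)

section \<open>Attempted mean size compared with truncated sums of sizes\<close>

text \<open>A policy-free quantity placed between the two sides: at level 2 it bounds what any
  adaptive policy attempts, at level 1 it is reached by a list.\<close>

definition truncated_sum :: "nat set \<Rightarrow> real \<Rightarrow> ennreal" where
  "truncated_sum J c = (\<integral>\<^sup>+ X. min (ennreal c) (\<Sum>i\<in>J. ennreal (min (X i) 1)) \<partial>PiM J M)"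

lemma prob_space_PiM_size: "prob_space (PiM J M)"
  by (rule prob_space_PiM) (rule prob_size)

lemma emeasure_PiM_size [simp]: "emeasure (PiM J M) (space (PiM J M)) = 1"
  by (rule prob_space.emeasure_space_1[OF prob_space_PiM_size])

lemma truncated_sum_insert:
  assumes "finite J" "i \<notin> J"
  shows "truncated_sum (insert i J) c
    = (\<integral>\<^sup>+ x. (\<integral>\<^sup>+ X. min (ennreal c) (ennreal (min x 1) + (\<Sum>j\<in>J. ennreal (min (X j) 1))) \<partial>PiM J M) \<partial>M i)"
proof -
  have "(\<Sum>j\<in>J. ennreal (min ((X(i := y)) j) 1)) = (\<Sum>j\<in>J. ennreal (min (X j) 1))" for X y
    using assms by (intro sum.cong) auto
  then show ?thesis
    unfolding truncated_sum_def using assms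
    by (subst product_nn_integral_insert_rev) auto
qed

lemma truncated_sum_mono: "c \<le> d \<Longrightarrow> truncated_sum J c \<le> truncated_sum J d"
  unfolding truncated_sum_def
  by (intro nn_integral_mono min.mono ennreal_leI) auto

text \<open>The source of the factor 2 lost on small items; it holds pointwise.\<close>

lemma truncated_sum_two: "truncated_sum J 2 \<le> 2 * truncated_sum J 1"
proof -
  have "min 2 a \<le> 2 * min 1 a" for a :: ennreal
  proof (cases "a \<le> 1")
    case True
    then have "min 1 a = a" by (simp add: min_def)
    then show ?thesis by (simp add: mult_2 min.coboundedI2)
  next
    case False
    then have "min 1 a = 1" by (simp add: min_def)
    then show ?thesis by simp
  qed
  then show ?thesis
    unfolding truncated_sum_def
    by (subst nn_integral_cmult[symmetric]) (auto intro!: nn_integral_mono)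
qed

lemma truncated_inner:
  assumes "0 \<le> x" "x \<le> c" "x \<le> 1" "finite J"
  shows "(\<integral>\<^sup>+ X. min (ennreal c) (ennreal (min x 1) + (\<Sum>j\<in>J. ennreal (min (X j) 1))) \<partial>PiM J M)
    = ennreal x + truncated_sum J (c - x)"
proof -
  have *: "min (ennreal c) (ennreal x + a) = ennreal x + min (ennreal (c - x)) a" for a
  proof (cases a)
    case (real r)
    then show ?thesis
      using assms by (auto simp: min_def ennreal_plus[symmetric] simp del: ennreal_plus)
  next
    case top
    then show ?thesis
      using assms by (auto simp: min_def ennreal_plus[symmetric] simp del: ennreal_plus)
  qed
  show ?thesis
    using assms unfolding truncated_sum_def
    by (simp add: * nn_integral_add)
qed

text \<open>An item is chosen before its size is seen, so its mean may be replaced by its realized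
  truncated size. The sizes that fit add up to at most \<open>1 - s\<close> and the overflowing item
  adds at most 1, hence the level \<open>2 - s\<close>. Items outside \<open>J\<close> are not
  charged and only use up capacity.\<close>

lemma opt_attempt_le_truncated_sum:
  assumes "finite B" "0 \<le> s" "s \<le> 1"
  shows "opt_attempt (\<lambda>i. if i \<in> J then mean_size i else 0) m B s \<le> truncated_sum (B \<inter> J) (2 - s)"
  using assms
proof (induction m arbitrary: B s)
  case 0
  then show ?case by simp
next
  case (Suc m)
  define u where "u = (\<lambda>i. if i \<in> J then mean_size i else 0)"
  have IH: "opt_attempt u m (B - {i}) t \<le> truncated_sum ((B - {i}) \<inter> J) (2 - t)"
    if "0 \<le> t" "t \<le> 1" for i t
    unfolding u_def using Suc.IH[of "B - {i}" t] Suc.prems that by auto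
  have "u i + step i (opt_attempt u m (B - {i})) s \<le> truncated_sum (B \<inter> J) (2 - s)" if i: "i \<in> B" for i
  proof (cases "i \<in> J")
    case True
    let ?J = "(B - {i}) \<inter> J"
    let ?inner = "\<lambda>x. \<integral>\<^sup>+ X. min (ennreal (2 - s)) (ennreal (min x 1) + (\<Sum>j\<in>?J. ennreal (min (X j) 1))) \<partial>PiM ?J M"
    have ui: "u i = mean_size i" using True by (simp add: u_def)
    have "B \<inter> J = insert i ?J" using i True by auto
    then have sum_eq: "truncated_sum (B \<inter> J) (2 - s) = (\<integral>\<^sup>+ x. ?inner x \<partial>M i)"
      using truncated_sum_insert[of ?J i] Suc.prems by simp
    \<comment> \<open>The charge for \<open>i\<close> and the continuation are put under one
      integral over the size of \<open>i\<close>, to be compared pointwise with the integrand of the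
      truncated sum.\<close>
    have "u i + step i (opt_attempt u m (B - {i})) s
        = (\<integral>\<^sup>+ x. ennreal (min x 1) + (if s + x \<le> 1 then opt_attempt u m (B - {i}) (s + x) else 0) \<partial>M i)"
      using ui by (simp add: mean_size_def step_def nn_integral_add)
    also have "\<dots> \<le> (\<integral>\<^sup>+ x. ?inner x \<partial>M i)"
    proof (rule nn_integral_mono_AE, use size_nonneg[of i] in eventually_elim)
      fix x :: real assume x: "0 \<le> x"
      show "ennreal (min x 1) + (if s + x \<le> 1 then opt_attempt u m (B - {i}) (s + x) else 0) \<le> ?inner x"
      proof (cases "s + x \<le> 1")
        case True
        then have "?inner x = ennreal x + truncated_sum ?J (2 - s - x)"
          using x Suc.prems by (intro truncated_inner) auto
        then show ?thesis
          using True x Suc.prems IH[of "s + x" i] by (simp add: add_left_mono diff_diff_eq)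
      next
        case False
        \<comment> \<open>On overflow only \<open>min x 1\<close> is charged, and the truncation
          leaves it intact since 1 \<le> \<open>2 - s\<close>.\<close>
        have "ennreal (min x 1) = (\<integral>\<^sup>+ X. ennreal (min x 1) \<partial>PiM ?J M)" by simp
        also have "\<dots> \<le> ?inner x"
          using x Suc.prems by (intro nn_integral_mono) (auto intro!: ennreal_leI)
        finally show ?thesis using False by simp
      qed
    qed
    finally show ?thesis using sum_eq by simp
  next
    case False
    then have "(B - {i}) \<inter> J = B \<inter> J" by auto
    moreover have "step i (opt_attempt u m (B - {i})) s \<le> truncated_sum ((B - {i}) \<inter> J) (2 - s)"
    proof (rule step_le_bound)
      fix t assume t: "s \<le> t" "t \<le> 1"
      then show "opt_attempt u m (B - {i}) t \<le> truncated_sum ((B - {i}) \<inter> J) (2 - s)"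
        using Suc.prems by (intro order_trans[OF IH truncated_sum_mono]) auto
    qed
    ultimately show ?thesis using False by (simp add: u_def)
  qed
  then show ?case unfolding u_def[symmetric] by (auto intro!: SUP_least)
qed

text \<open>Either every item of the list is attempted, or an overflow occurs and the truncated
  sizes attempted already reach \<open>1 - s\<close>.\<close>

lemma truncated_sum_le_list_attempt:
  assumes "distinct l" "0 \<le> s" "s \<le> 1"
  shows "truncated_sum (set l) (1 - s) \<le> list_attempt mean_size l s"
  using assms
proof (induction l arbitrary: s)
  case Nil
  then show ?case by (simp add: truncated_sum_def)
next
  case (Cons i l)
  let ?inner = "\<lambda>x. \<integral>\<^sup>+ X. min (ennreal (1 - s)) (ennreal (min x 1) + (\<Sum>j\<in>set l. ennreal (min (X j) 1))) \<partial>PiM (set l) M"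
  have "truncated_sum (set (i # l)) (1 - s) = (\<integral>\<^sup>+ x. ?inner x \<partial>M i)"
    using truncated_sum_insert[of "set l" i] Cons.prems by simp
  also have "\<dots> \<le> (\<integral>\<^sup>+ x. ennreal (min x 1) + (if s + x \<le> 1 then list_attempt mean_size l (s + x) else 0) \<partial>M i)"
  proof (rule nn_integral_mono_AE, use size_nonneg[of i] in eventually_elim)
    fix x :: real assume x: "0 \<le> x"
    show "?inner x \<le> ennreal (min x 1) + (if s + x \<le> 1 then list_attempt mean_size l (s + x) else 0)"
    proof (cases "s + x \<le> 1")
      case True
      then have "?inner x = ennreal x + truncated_sum (set l) (1 - s - x)"
        using x Cons.prems by (intro truncated_inner) auto
      then show ?thesis
        using True x Cons.prems Cons.IH[of "s + x"] by (simp add: add_left_mono diff_diff_eq)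
    next
      case False
      \<comment> \<open>Overflow and 0 \<le> \<open>s\<close> give \<open>min x 1\<close> \<ge>
        \<open>1 - s\<close>, so the item alone reaches the truncation level.\<close>
      have "?inner x \<le> (\<integral>\<^sup>+ X. ennreal (min x 1) \<partial>PiM (set l) M)"
        using x Cons.prems False by (intro nn_integral_mono) (auto intro!: ennreal_leI min.coboundedI1)
      then show ?thesis using False by simp
    qed
  qed
  also have "\<dots> = list_attempt mean_size (i # l) s"
    by (simp add: mean_size_def step_def nn_integral_add)
  finally show ?case .
qed

section \<open>The cost of not being paid for the overflowing item\<close>

primrec overflow_prob :: "nat list \<Rightarrow> real \<Rightarrow> ennreal" where
  "overflow_prob [] s = 0"
| "overflow_prob (i # l) s = (\<integral>\<^sup>+ x. (if s + x \<le> 1 then overflow_prob l (s + x) else 1) \<partial>M i)"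

lemma measurable_overflow_prob [measurable]: "overflow_prob l \<in> borel_measurable borel"
proof (induction l)
  case Nil
  then show ?case by (simp add: overflow_prob.simps(1)[abs_def])
next
  case (Cons i l)
  note [measurable] = Cons
  interpret sigma_finite_measure "M i" by (rule sigma_finite_size)
  have "(\<lambda>s. \<integral>\<^sup>+ x. (if s + x \<le> 1 then overflow_prob l (s + x) else 1) \<partial>M i) \<in> borel_measurable borel"
    by measurable
  then show ?case by (simp add: overflow_prob.simps(2)[abs_def])
qed

lemma overflow_prob_le_1: "overflow_prob l s \<le> 1"
proof (induction l arbitrary: s)
  case (Cons i l)
  have "overflow_prob (i # l) s \<le> (\<integral>\<^sup>+ x. 1 \<partial>M i)"
    unfolding overflow_prob.simps by (intro nn_integral_mono) (auto simp: Cons)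
  then show ?case by simp
qed simp

text \<open>The two payments differ only by the overflowing item, which is worth at most
  \<open>c\<close> and exists only on the overflow event.\<close>

lemma list_attempt_le_list_value:
  assumes "\<And>i. i \<in> set l \<Longrightarrow> u i \<le> c"
  shows "list_attempt u l s \<le> list_value u l s + c * overflow_prob l s"
  using assms
proof (induction l arbitrary: s)
  case (Cons i l)
  have "list_attempt u (i # l) s \<le> u i + step i (\<lambda>t. list_value u l t + c * overflow_prob l t) s"
    unfolding list_attempt.simps by (intro add_left_mono step_mono Cons) (use Cons.prems in auto)
  also have "\<dots> = (\<integral>\<^sup>+ x. u i + (if s + x \<le> 1 then list_value u l (s + x) + c * overflow_prob l (s + x) else 0) \<partial>M i)"
    by (subst nn_integral_add) (auto simp: step_def)
  also have "\<dots> \<le> (\<integral>\<^sup>+ x. (if s + x \<le> 1 then u i + list_value u l (s + x) else 0)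
      + c * (if s + x \<le> 1 then overflow_prob l (s + x) else 1) \<partial>M i)"
    using Cons.prems by (intro nn_integral_mono) (auto simp: add.assoc)
  also have "\<dots> = list_value u (i # l) s + c * overflow_prob (i # l) s"
    by (subst nn_integral_add) (auto simp: step_def nn_integral_cmult)
  finally show ?case .
qed simp

text \<open>Markov's inequality: on overflow the attempted truncated sizes amount to at least the
  free capacity, and their expectation is the attempted mean size.\<close>

lemma overflow_prob_le_list_attempt:
  assumes "0 \<le> s" "s \<le> 1"
  shows "ennreal (1 - s) * overflow_prob l s \<le> list_attempt mean_size l s"
  using assms
proof (induction l arbitrary: s)
  case (Cons i l)
  have "ennreal (1 - s) * overflow_prob (i # l) s
      = (\<integral>\<^sup>+ x. ennreal (1 - s) * (if s + x \<le> 1 then overflow_prob l (s + x) else 1) \<partial>M i)"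
    by (simp add: nn_integral_cmult)
  also have "\<dots> \<le> (\<integral>\<^sup>+ x. ennreal (min x 1) + (if s + x \<le> 1 then list_attempt mean_size l (s + x) else 0) \<partial>M i)"
  proof (rule nn_integral_mono_AE, use size_nonneg[of i] in eventually_elim)
    fix x :: real assume x: "0 \<le> x"
    show "ennreal (1 - s) * (if s + x \<le> 1 then overflow_prob l (s + x) else 1)
        \<le> ennreal (min x 1) + (if s + x \<le> 1 then list_attempt mean_size l (s + x) else 0)"
    proof (cases "s + x \<le> 1")
      case True
      \<comment> \<open>The free capacity is divided into \<open>x\<close>, charged to the current
        item, and the rest, left to the induction hypothesis.\<close>
      have "ennreal (1 - s) * overflow_prob l (s + x)
          = (ennreal x + ennreal (1 - (s + x))) * overflow_prob l (s + x)"
        using True x by (simp add: ennreal_plus[symmetric] del: ennreal_plus)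
      also have "\<dots> \<le> ennreal x * 1 + list_attempt mean_size l (s + x)"
        unfolding distrib_right using True x Cons.prems
        by (intro add_mono mult_left_mono overflow_prob_le_1 Cons.IH) auto
      finally show ?thesis using True x Cons.prems by simp
    next
      case False
      then show ?thesis using x Cons.prems by (auto intro!: ennreal_leI)
    qed
  qed
  also have "\<dots> = list_attempt mean_size (i # l) s"
    by (simp add: mean_size_def step_def nn_integral_add)
  finally show ?case .
qed simp

section \<open>The greedy list for small items\<close>

text \<open>The two inequalities are bundled because the value functions \<open>u\<close> satisfying
  them form a convex cone; it then suffices to verify them on generators.\<close>

definition greedy_bounds :: "nat list \<Rightarrow> nat \<Rightarrow> ennreal \<Rightarrow> (nat \<Rightarrow> ennreal) \<Rightarrow> bool" where
  "greedy_bounds l m c u \<longleftrightarrow>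
    opt_attempt u m (set l) 0 \<le> 2 * list_attempt u l 0 \<and>
    list_attempt u l 0 \<le> list_value u l 0 + c * list_attempt u l 0"

lemma greedy_bounds_cong:
  assumes "\<And>i. i \<in> set l \<Longrightarrow> u i = w i"
  shows "greedy_bounds l m c u \<longleftrightarrow> greedy_bounds l m c w"
  unfolding greedy_bounds_def
  using opt_attempt_cong[of "set l" u w] list_attempt_cong[of l u w] list_value_cong[of l u w] assms
  by simp

lemma greedy_bounds_add:
  assumes "greedy_bounds l m c u" "greedy_bounds l m c w"
  shows "greedy_bounds l m c (\<lambda>i. u i + w i)"
  unfolding greedy_bounds_def
proof
  show "opt_attempt (\<lambda>i. u i + w i) m (set l) 0 \<le> 2 * list_attempt (\<lambda>i. u i + w i) l 0"
    using assms opt_attempt_add[of u w m "set l" 0] add_mono order_trans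
    unfolding greedy_bounds_def list_attempt_add distrib_left by blast
  have "list_attempt u l 0 + list_attempt w l 0
      \<le> (list_value u l 0 + c * list_attempt u l 0) + (list_value w l 0 + c * list_attempt w l 0)"
    using assms by (intro add_mono) (auto simp: greedy_bounds_def)
  then show "list_attempt (\<lambda>i. u i + w i) l 0
      \<le> list_value (\<lambda>i. u i + w i) l 0 + c * list_attempt (\<lambda>i. u i + w i) l 0"
    by (simp add: list_attempt_add list_value_add distrib_left ac_simps)
qed

lemma greedy_bounds_cmult:
  assumes "greedy_bounds l m c u"
  shows "greedy_bounds l m c (\<lambda>i. a * u i)"
  unfolding greedy_bounds_def
proof
  have "a * opt_attempt u m (set l) 0 \<le> a * (2 * list_attempt u l 0)"
    using assms by (intro mult_left_mono) (auto simp: greedy_bounds_def)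
  then show "opt_attempt (\<lambda>i. a * u i) m (set l) 0 \<le> 2 * list_attempt (\<lambda>i. a * u i) l 0"
    using order_trans[OF opt_attempt_cmult] by (simp add: list_attempt_cmult ac_simps)
  have "a * list_attempt u l 0 \<le> a * (list_value u l 0 + c * list_attempt u l 0)"
    using assms by (intro mult_left_mono) (auto simp: greedy_bounds_def)
  then show "list_attempt (\<lambda>i. a * u i) l 0
      \<le> list_value (\<lambda>i. a * u i) l 0 + c * list_attempt (\<lambda>i. a * u i) l 0"
    by (simp add: list_attempt_cmult list_value_cmult distrib_left ac_simps)
qed

text \<open>These are the generators of the cone. When the values are the mean sizes of a prefix,
  both sides compare with the truncated sum over that prefix, and the expected loss on overflow is
  at most \<open>c\<close> times the attempted value by Markov's inequality.\<close>

lemma greedy_bounds_prefix: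
  assumes "distinct (l @ l')" and "\<And>i. i \<in> set l \<Longrightarrow> mean_size i \<le> c"
  shows "greedy_bounds (l @ l') m c (\<lambda>i. if i \<in> set l then mean_size i else 0)"
proof -
  define u where "u = (\<lambda>i. if i \<in> set l then mean_size i else 0)"
  have z: "\<And>i. i \<in> set l' \<Longrightarrow> u i = 0" using assms(1) by (auto simp: u_def)
  have cong: "\<And>i. i \<in> set l \<Longrightarrow> u i = mean_size i" by (simp add: u_def)
  have G: "list_attempt u (l @ l') = list_attempt mean_size l"
    using list_attempt_append[OF z] list_attempt_cong[OF cong] by simp
  have R: "list_value u (l @ l') = list_value mean_size l"
    using list_value_append[OF z] list_value_cong[OF cong] by simp
  have "opt_attempt u m (set (l @ l')) 0 \<le> truncated_sum (set (l @ l') \<inter> set l) (2 - 0)"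
    unfolding u_def by (rule opt_attempt_le_truncated_sum) auto
  also have "\<dots> = truncated_sum (set l) 2" by (simp add: Int_commute Un_Int_distrib)
  also have "\<dots> \<le> 2 * truncated_sum (set l) 1" by (rule truncated_sum_two)
  also have "\<dots> \<le> 2 * list_attempt mean_size l 0"
    using truncated_sum_le_list_attempt[of l 0] assms by (intro mult_left_mono) auto
  finally have 1: "opt_attempt u m (set (l @ l')) 0 \<le> 2 * list_attempt mean_size l 0" .
  have "list_attempt mean_size l 0 \<le> list_value mean_size l 0 + c * overflow_prob l 0"
    by (rule list_attempt_le_list_value) (rule assms)
  also have "\<dots> \<le> list_value mean_size l 0 + c * list_attempt mean_size l 0"
    using overflow_prob_le_list_attempt[of 0 l] by (intro add_left_mono mult_left_mono) auto
  finally show ?thesis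
    using 1 G R unfolding greedy_bounds_def u_def[symmetric] by simp
qed

lemma AE_size_eq_0:
  assumes "mean_size i = 0"
  shows "AE x in M i. x = 0"
proof -
  have "AE x in M i. ennreal (min x 1) = 0"
    using assms unfolding mean_size_def by (subst (asm) nn_integral_0_iff_AE) auto
  with size_nonneg[of i] show ?thesis
    by eventually_elim (auto simp: ennreal_eq_0_iff min_def split: if_splits)
qed

lemma step_size_eq_0:
  assumes "mean_size i = 0" "s \<le> 1" and [measurable]: "f \<in> borel_measurable borel"
  shows "step i f s = f s"
proof -
  have "AE x in M i. (if s + x \<le> 1 then f (s + x) else 0) = f s"
    using AE_size_eq_0[OF assms(1)] by eventually_elim (use assms(2) in simp)
  then have "step i f s = (\<integral>\<^sup>+ x. f s \<partial>M i)"
    unfolding step_def by (rule nn_integral_cong_AE)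
  then show ?thesis by simp
qed

text \<open>Items of mean size 0 have no finite ratio and lie outside the span of the prefix
  generators. They almost surely use no capacity, so a list starting with them collects all their
  value.\<close>

lemma greedy_bounds_size_eq_0:
  assumes "distinct (l @ l')" "\<And>i. i \<in> set l \<Longrightarrow> mean_size i = 0"
  shows "greedy_bounds (l @ l') m c (\<lambda>i. if i \<in> set l then v i else 0)"
proof -
  define u where "u = (\<lambda>i. if i \<in> set l then v i else 0)"
  have z: "\<And>i. i \<in> set l' \<Longrightarrow> u i = 0" using assms(1) by (auto simp: u_def)
  have *: "list_attempt w l 0 = sum w (set l) \<and> list_value w l 0 = sum w (set l)" for w
    using assms by (induction l) (auto simp: step_size_eq_0)
  have "opt_attempt u m (set (l @ l')) 0 \<le> sum u (set (l @ l'))"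
    by (rule opt_attempt_le_sum) simp
  also have "\<dots> = sum u (set l)"
    using z by (intro sum.mono_neutral_right) auto
  also have "\<dots> \<le> 2 * sum u (set l)" by (simp add: mult_2)
  finally show ?thesis
    using * unfolding greedy_bounds_def u_def[symmetric]
    by (simp add: list_attempt_append[OF z] list_value_append[OF z])
qed

text \<open>Summation by parts from the right: for the last item \<open>j\<close>, the values are
  \<open>r j\<close> times the mean sizes on the whole prefix plus the nonnegative excess
  \<open>r i - r j\<close> on the earlier items. The suffix \<open>l'\<close> takes up the items
  already peeled off.\<close>

lemma greedy_bounds_sorted:
  assumes "distinct (lz @ l @ l')" "\<And>i. i \<in> set lz \<Longrightarrow> mean_size i = 0"
    and "\<And>i. i \<in> set l \<Longrightarrow> mean_size i \<le> c"
    and "sorted_wrt (\<lambda>i j. r j \<le> r i) l"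
  shows "greedy_bounds (lz @ l @ l') m c (\<lambda>i. if i \<in> set l then r i * mean_size i else 0)"
  using assms
proof (induction l arbitrary: l' r rule: rev_induct)
  case Nil
  then show ?case
    using greedy_bounds_size_eq_0[of lz l' m c "\<lambda>_. 0"] by simp
next
  case (snoc j l)
  let ?l = "lz @ (l @ [j]) @ l'"
  define d where "d = (\<lambda>i. r i - r j)"
  have rj: "r j \<le> r i" if "i \<in> set l" for i
    using snoc.prems(4) that by (auto simp: sorted_wrt_append)
  have "sorted_wrt (\<lambda>i i'. r i' \<le> r i) l"
    using snoc.prems(4) by (simp add: sorted_wrt_append)
  then have "sorted_wrt (\<lambda>i i'. d i' \<le> d i) l"
    by (rule sorted_wrt_mono_rel[rotated]) (auto simp: d_def intro!: ennreal_minus_mono)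
  then have "greedy_bounds (lz @ l @ [j] @ l') m c (\<lambda>i. if i \<in> set l then d i * mean_size i else 0)"
    using snoc.prems by (intro snoc.IH) auto
  then have 1: "greedy_bounds ?l m c (\<lambda>i. if i \<in> set l then d i * mean_size i else 0)"
    by simp
  \<comment> \<open>The prefix has to contain \<open>lz\<close> as well, which changes no value
    because mean sizes vanish there.\<close>
  have "greedy_bounds ((lz @ l @ [j]) @ l') m c (\<lambda>i. if i \<in> set (lz @ l @ [j]) then mean_size i else 0)"
    using snoc.prems by (intro greedy_bounds_prefix) auto
  then have "greedy_bounds ?l m c (\<lambda>i. if i \<in> set (lz @ l @ [j]) then mean_size i else 0)"
    by simp
  from greedy_bounds_add[OF 1 greedy_bounds_cmult[OF this, of "r j"]]
  show ?case
  proof (rule greedy_bounds_cong[THEN iffD1, rotated])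
    fix i assume "i \<in> set ?l"
    show "(if i \<in> set l then d i * mean_size i else 0)
        + r j * (if i \<in> set (lz @ l @ [j]) then mean_size i else 0)
      = (if i \<in> set (l @ [j]) then r i * mean_size i else 0)"
      using rj[of i] snoc.prems(1,2)
      by (auto simp: d_def distrib_right[symmetric] diff_add_cancel_ennreal)
  qed
qed

lemma ex_greedy_list:
  assumes "finite B" "\<And>i. i \<in> B \<Longrightarrow> mean_size i \<le> c"
  obtains l where "distinct l" "set l = B" "greedy_bounds l m c v"
proof -
  \<comment> \<open>In \<open>ennreal\<close> this ratio is infinite or 0 when the mean size is 0,
    so such items are collected in \<open>lz\<close> and put first.\<close>
  define r where "r i = v i / mean_size i" for i
  obtain lz where lz: "distinct lz" "set lz = {i \<in> B. mean_size i = 0}"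
    using finite_distinct_list[of "{i \<in> B. mean_size i = 0}"] assms by auto
  obtain l0 where l0: "distinct l0" "set l0 = {i \<in> B. mean_size i \<noteq> 0}"
    using finite_distinct_list[of "{i \<in> B. mean_size i \<noteq> 0}"] assms by auto
  define l where "l = rev (sort_key r l0)"
  have l: "distinct l" "set l = {i \<in> B. mean_size i \<noteq> 0}"
    using l0 by (auto simp: l_def)
  have "sorted (map r (sort_key r l0))" by simp
  then have sorted: "sorted_wrt (\<lambda>i j. r j \<le> r i) l"
    unfolding l_def sorted_wrt_rev by (simp add: sorted_map)
  have mean: "mean_size i \<le> 1" for i
  proof -
    have "mean_size i \<le> (\<integral>\<^sup>+ x. 1 \<partial>M i)"
      unfolding mean_size_def by (intro nn_integral_mono) (simp add: ennreal_leI flip: ennreal_1)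
    then show ?thesis by simp
  qed
  have dist: "distinct (lz @ l)" using lz l by auto
  have 1: "greedy_bounds (lz @ l) m c (\<lambda>i. if i \<in> set lz then v i else 0)"
    using dist lz by (intro greedy_bounds_size_eq_0) auto
  have "greedy_bounds (lz @ l @ []) m c (\<lambda>i. if i \<in> set l then r i * mean_size i else 0)"
    using dist lz l assms sorted by (intro greedy_bounds_sorted) auto
  then have "greedy_bounds (lz @ l) m c (\<lambda>i. if i \<in> set l then r i * mean_size i else 0)"
    by simp
  from greedy_bounds_add[OF 1 this] have "greedy_bounds (lz @ l) m c v"
  proof (rule greedy_bounds_cong[THEN iffD1, rotated])
    fix i assume i: "i \<in> set (lz @ l)"
    \<comment> \<open>Cancelling \<open>mean_size i\<close> in the ratio requires it to be finite as
      well as nonzero.\<close>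
    have "mean_size i \<noteq> \<top>" using mean[of i] by (auto simp: top_unique)
    then have "r i * mean_size i = v i" if "mean_size i \<noteq> 0"
      using that by (simp add: r_def ennreal_divide_times ennreal_divide_self top.not_eq_extremum)
    then show "(if i \<in> set lz then v i else 0) + (if i \<in> set l then r i * mean_size i else 0) = v i"
      using lz(2) l(2) i by auto
  qed
  moreover have "set (lz @ l) = B" using lz l by auto
  ultimately show ?thesis using that[of "lz @ l"] dist by simp
qed

section \<open>Large items: exponentially small survival probability\<close>

text \<open>The weight \<open>exp (1 - t)\<close> is at least 1 as long as nothing has overflowed,
  and each large insertion shrinks its killed expectation by the factor
  \<open>1 - \<delta> / 2\<close>. Iteration gives the Chernoff bound.\<close>

lemma step_exp_le:
  assumes "ennreal \<delta> \<le> mean_size i" "0 \<le> \<delta>" "0 \<le> s"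
  shows "step i (\<lambda>t. ennreal (exp (1 - t))) s \<le> ennreal (exp (1 - s) * (1 - \<delta> / 2))"
proof -
  let ?I = "\<integral>\<^sup>+ x. ennreal (1 - max 0 (min x 1) / 2) \<partial>M i"
  \<comment> \<open>Stated as a sum equal to 1 to avoid subtraction in \<open>ennreal\<close>; the
    \<open>max 0\<close> makes it hold at negative \<open>x\<close> too.\<close>
  have eq: "ennreal (1 - max 0 (min x 1) / 2) + ennreal (1/2) * ennreal (min x 1) = 1" for x :: real
  proof -
    have "ennreal (1/2) * ennreal (min x 1) = ennreal (max 0 (min x 1) / 2)"
      by (subst ennreal_mult'[symmetric]) (auto simp: ennreal_neg max_def)
    then show ?thesis
      by (simp add: ennreal_plus[symmetric] max_def del: ennreal_plus)
  qed
  have "?I + ennreal (1/2) * mean_size i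
      = (\<integral>\<^sup>+ x. ennreal (1 - max 0 (min x 1) / 2) + ennreal (1/2) * ennreal (min x 1) \<partial>M i)"
    by (simp add: mean_size_def nn_integral_add nn_integral_cmult)
  also have "\<dots> = (\<integral>\<^sup>+ x. 1 \<partial>M i)" by (simp only: eq)
  finally have sum: "?I + ennreal (1/2) * mean_size i = 1" by simp
  have "ennreal (\<delta> / 2) = ennreal (1/2) * ennreal \<delta>"
    by (subst ennreal_mult'[symmetric]) auto
  also have "\<dots> \<le> ennreal (1/2) * mean_size i" by (intro mult_left_mono assms) auto
  finally have le: "?I + ennreal (\<delta> / 2) \<le> 1" using sum by (metis add_left_mono)
  have I: "?I \<le> ennreal (1 - \<delta> / 2)"
  proof (cases ?I)
    case (real r)
    then show ?thesis using le assms
      by (simp add: ennreal_plus[symmetric] ennreal_leI del: ennreal_plus)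
  next
    case top
    then show ?thesis using le by (simp add: top_unique)
  qed
  have "step i (\<lambda>t. ennreal (exp (1 - t))) s
      \<le> (\<integral>\<^sup>+ x. ennreal (exp (1 - s)) * ennreal (1 - max 0 (min x 1) / 2) \<partial>M i)"
    unfolding step_def
  proof (rule nn_integral_mono_AE, use size_nonneg[of i] in eventually_elim)
    fix x :: real assume x: "0 \<le> x"
    show "(if s + x \<le> 1 then ennreal (exp (1 - (s + x))) else 0)
        \<le> ennreal (exp (1 - s)) * ennreal (1 - max 0 (min x 1) / 2)"
    proof (cases "s + x \<le> 1")
      case True
      then have "x \<le> 1" using assms by simp
      have "exp (1 - (s + x)) = exp (1 - s) * exp (- x)" by (simp add: exp_add[symmetric])
      also have "\<dots> \<le> exp (1 - s) * (1 - x / 2)"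
        using exp_minus_le[of x] x \<open>x \<le> 1\<close> by (intro mult_left_mono) auto
      finally show ?thesis
        using True x \<open>x \<le> 1\<close> by (simp add: ennreal_mult[symmetric] ennreal_leI)
    qed simp
  qed
  also have "\<dots> = ennreal (exp (1 - s)) * ?I" by (rule nn_integral_cmult) simp
  also have "\<dots> \<le> ennreal (exp (1 - s)) * ennreal (1 - \<delta> / 2)"
    by (intro mult_left_mono I) auto
  also have "\<dots> = ennreal (exp (1 - s) * (1 - \<delta> / 2))" by (simp add: ennreal_mult')
  finally show ?thesis .
qed

text \<open>Whatever is collected after \<open>m\<close> insertions is at most a fresh optimum from
  the empty knapsack, weighted by a bound on the probability of surviving so long. The reference
  \<open>opt u N' C 0\<close> stays fixed while \<open>N\<close>, \<open>B\<close> and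
  \<open>s\<close> change in the induction.\<close>

lemma opt_le_truncated_opt:
  assumes "\<And>i. i \<in> C \<Longrightarrow> ennreal \<delta> \<le> mean_size i" "0 \<le> \<delta>" "\<delta> \<le> 1"
    and "0 \<le> s" "s \<le> 1" "B \<subseteq> C" "N \<le> N'"
  shows "opt u N B s \<le> opt u m B s + ennreal (exp (1 - s) * (1 - \<delta> / 2) ^ m) * opt u N' C 0"
  using assms(4-)
proof (induction m arbitrary: N B s)
  case 0
  have "opt u N B s \<le> opt u N' C s" by (rule opt_mono) (use 0 in auto)
  also have "\<dots> \<le> opt u N' C 0" using antimonoD[OF antimono_opt] 0 by blast
  also have "\<dots> = 1 * opt u N' C 0" by simp
  also have "\<dots> \<le> ennreal (exp (1 - s)) * opt u N' C 0"
    using 0 by (intro mult_right_mono) auto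
  finally show ?case by simp
next
  case (Suc m)
  \<comment> \<open>The part of the error free of the capacity \<open>t\<close>, which can be pulled
    out of \<open>step\<close>.\<close>
  define K where "K = ennreal ((1 - \<delta> / 2) ^ m) * opt u N' C 0"
  show ?case
  proof (cases N)
    case (Suc N0)
    show ?thesis
      unfolding Suc opt.simps(2)[of u N0]
    proof (rule SUP_least)
      fix i assume i: "i \<in> B"
      have "step i (\<lambda>t. u i + opt u N0 (B - {i}) t) s
        \<le> step i (\<lambda>t. (u i + opt u m (B - {i}) t) + K * ennreal (exp (1 - t))) s"
      proof (rule step_mono)
        fix t assume t: "s \<le> t" "t \<le> 1"
        have "opt u N0 (B - {i}) t
          \<le> opt u m (B - {i}) t + ennreal (exp (1 - t) * (1 - \<delta> / 2) ^ m) * opt u N' C 0"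
          by (rule Suc.IH) (use t Suc.prems Suc in auto)
        also have "\<dots> = opt u m (B - {i}) t + K * ennreal (exp (1 - t))"
          using assms(3) by (simp add: K_def ennreal_mult ac_simps)
        finally show "u i + opt u N0 (B - {i}) t \<le> (u i + opt u m (B - {i}) t) + K * ennreal (exp (1 - t))"
          by (simp add: add.assoc add_left_mono)
      qed
      also have "\<dots> = step i (\<lambda>t. u i + opt u m (B - {i}) t) s + K * step i (\<lambda>t. ennreal (exp (1 - t))) s"
        by (subst step_add, simp, simp, subst step_cmult) auto
      also have "\<dots> \<le> opt u (Suc m) B s + K * ennreal (exp (1 - s) * (1 - \<delta> / 2))"
        unfolding opt.simps
        by (intro add_mono SUP_upper i mult_left_mono step_exp_le) (use assms i Suc.prems in auto)
      also have "K * ennreal (exp (1 - s) * (1 - \<delta> / 2))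
        = ennreal (exp (1 - s) * (1 - \<delta> / 2) ^ Suc m) * opt u N' C 0"
        using assms(3) by (simp add: K_def ennreal_mult ac_simps)
      finally show "step i (\<lambda>t. u i + opt u N0 (B - {i}) t) s
        \<le> opt u (Suc m) B s + ennreal (exp (1 - s) * (1 - \<delta> / 2) ^ Suc m) * opt u N' C 0" .
    qed
  qed simp
qed

section \<open>Policies that realize the recursive values\<close>

lemma list_attempt_le_sum_list: "list_attempt u l s \<le> sum_list (map u l)"
  by (induction l arbitrary: s) (auto intro!: add_left_mono step_le_bound)

text \<open>The used capacity is an argument of \<open>P\<close>, so that \<open>P\<close> can
  itself be the branching of a \<open>Query\<close>. Joint measurability is demanded because that
  branching is evaluated at the random capacity left by earlier insertions.\<close>

definition achieves ::
  "(nat \<Rightarrow> real) \<Rightarrow> nat set \<Rightarrow> nat \<Rightarrow> (real \<Rightarrow> policy) \<Rightarrow> (real \<Rightarrow> ennreal) \<Rightarrow> bool" where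
  "achieves v A k P f \<longleftrightarrow>
    (\<forall>s. semi_adaptive A k (P s)) \<and>
    (\<lambda>(s, X). reward v X (P s) s) \<in> borel_measurable (borel \<Otimes>\<^sub>M PiM A M) \<and>
    (\<forall>s. (\<integral>\<^sup>+ X. ennreal (reward v X (P s) s) \<partial>PiM A M) = f s)"

lemma achieves_Stop: "achieves v A k (\<lambda>_. Stop) (\<lambda>_. 0)"
  by (simp add: achieves_def semi_adaptive.intros)

lemma measurable_achieves:
  assumes "achieves v A k P f"
  shows "(\<lambda>X. reward v X (P s) s) \<in> borel_measurable (PiM A M)"
proof -
  have "(\<lambda>(s, X). reward v X (P s) s) \<in> borel_measurable (borel \<Otimes>\<^sub>M PiM A M)"
    using assms by (simp add: achieves_def)
  from measurable_compose[OF measurable_Pair1'[of s] this] show ?thesis by simp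
qed

text \<open>The continuation \<open>T\<close> need only have the same reward as \<open>P\<close>. It
  is \<open>Query P\<close> for an adaptive policy and the constant value of \<open>P\<close> for a
  list, with \<open>k'\<close> counting the queries in either case.\<close>

lemma achieves_Insert:
  assumes P: "achieves v (A - {i}) k P f" and A: "finite A" "i \<in> A"
    and nonneg: "\<And>j. j \<in> A \<Longrightarrow> 0 \<le> v j"
    and T: "semi_adaptive (A - {i}) k' T" "\<And>X s. reward v X T s = reward v X (P s) s"
  shows "achieves v A k' (\<lambda>_. Insert i T) (step i (\<lambda>t. ennreal (v i) + f t))"
proof -
  have sa: "semi_adaptive (A - {i}) k (P s)" for s using P by (simp add: achieves_def)
  have [measurable]: "(\<lambda>(s, X). reward v X (P s) s) \<in> borel_measurable (borel \<Otimes>\<^sub>M PiM (A - {i}) M)"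
    using P by (simp add: achieves_def)
  have [measurable]: "(\<lambda>X. X i) \<in> borel_measurable (PiM A M)"
    using A measurable_component_singleton[of i A M] by (simp cong: measurable_cong_sets add: sets_size)
  have restr [measurable]: "(\<lambda>X. restrict X (A - {i})) \<in> measurable (PiM A M) (PiM (A - {i}) M)"
    by (rule measurable_restrict_subset) auto
  \<comment> \<open>The continuation never looks at coordinate \<open>i\<close>; restricting to the
    other coordinates brings in the measurability known for \<open>P\<close>.\<close>
  have "reward v X (P s) s = reward v (restrict X (A - {i})) (P s) s" for X s
    by (rule reward_cong[OF sa]) auto
  then have eq: "reward v X (Insert i T) s = (if s + X i \<le> 1
      then v i + (\<lambda>(s, X). reward v X (P s) s) (s + X i, restrict X (A - {i})) else 0)" for X s
    by (simp add: T)
  have meas: "(\<lambda>(s, X). reward v X (Insert i T) s) \<in> borel_measurable (borel \<Otimes>\<^sub>M PiM A M)"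
    unfolding eq by measurable
  have "(\<integral>\<^sup>+ X. ennreal (reward v X (Insert i T) s) \<partial>PiM A M) = step i (\<lambda>t. ennreal (v i) + f t) s" for s
  proof -
    have ins: "insert i (A - {i}) = A" using A by auto
    have m: "(\<lambda>X. ennreal (reward v X (Insert i T) s)) \<in> borel_measurable (PiM A M)"
      using measurable_compose[OF measurable_Pair1'[of s] meas] by simp
    have "(\<integral>\<^sup>+ X. ennreal (reward v X (Insert i T) s) \<partial>PiM A M)
      = (\<integral>\<^sup>+ y. (\<integral>\<^sup>+ X. ennreal (reward v (X(i := y)) (Insert i T) s) \<partial>PiM (A - {i}) M) \<partial>M i)"
      using product_nn_integral_insert_rev[of "A - {i}" i "\<lambda>X. ennreal (reward v X (Insert i T) s)", unfolded ins] A m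
      by (simp del: reward.simps)
    also have "\<dots> = (\<integral>\<^sup>+ y. (if s + y \<le> 1 then ennreal (v i) + f (s + y) else 0) \<partial>M i)"
    proof (rule nn_integral_cong)
      fix y
      have "(\<integral>\<^sup>+ X. ennreal (reward v (X(i := y)) (Insert i T) s) \<partial>PiM (A - {i}) M)
        = (\<integral>\<^sup>+ X. ennreal (v i) + ennreal (reward v X (P (s + y)) (s + y)) \<partial>PiM (A - {i}) M)"
        if "s + y \<le> 1"
      proof (rule nn_integral_cong)
        fix X
        have "reward v (X(i := y)) (P (s + y)) (s + y) = reward v X (P (s + y)) (s + y)"
          by (rule reward_cong[OF sa]) auto
        moreover have "0 \<le> reward v X (P (s + y)) (s + y)"
          by (rule reward_nonneg[OF sa]) (use nonneg in auto)
        ultimately show "ennreal (reward v (X(i := y)) (Insert i T) s)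
          = ennreal (v i) + ennreal (reward v X (P (s + y)) (s + y))"
          using that nonneg A by (simp add: T)
      qed
      also have "\<dots> = ennreal (v i) + f (s + y)"
        using P measurable_achieves[OF P, of "s + y"]
        by (subst nn_integral_add) (auto simp: achieves_def)
      finally show "(\<integral>\<^sup>+ X. ennreal (reward v (X(i := y)) (Insert i T) s) \<partial>PiM (A - {i}) M)
        = (if s + y \<le> 1 then ennreal (v i) + f (s + y) else 0)"
        by simp
    qed
    finally show ?thesis by (simp add: step_def)
  qed
  then show ?thesis
    using meas T(1) A by (auto simp: achieves_def intro: semi_adaptive.intros)
qed

text \<open>The better policy is selected by comparing the Borel functions \<open>f\<close> and
  \<open>g\<close> at the known capacity, which costs no query and keeps the branching
  measurable.\<close>

lemma achieves_max:
  assumes "achieves v A k P f" "achieves v A k Q g"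
    and [measurable]: "f \<in> borel_measurable borel" "g \<in> borel_measurable borel"
  shows "achieves v A k (\<lambda>s. if g s \<le> f s then P s else Q s) (\<lambda>s. max (f s) (g s))"
proof -
  have [measurable]: "(\<lambda>(s, X). reward v X (P s) s) \<in> borel_measurable (borel \<Otimes>\<^sub>M PiM A M)"
      "(\<lambda>(s, X). reward v X (Q s) s) \<in> borel_measurable (borel \<Otimes>\<^sub>M PiM A M)"
    using assms by (auto simp: achieves_def)
  have "(\<lambda>z. if g (fst z) \<le> f (fst z) then (\<lambda>(s, X). reward v X (P s) s) z
      else (\<lambda>(s, X). reward v X (Q s) s) z) \<in> borel_measurable (borel \<Otimes>\<^sub>M PiM A M)"
    by measurable
  also have "(\<lambda>z. if g (fst z) \<le> f (fst z) then (\<lambda>(s, X). reward v X (P s) s) z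
      else (\<lambda>(s, X). reward v X (Q s) s) z)
    = (\<lambda>(s, X). reward v X (if g s \<le> f s then P s else Q s) s)"
    by auto
  finally show ?thesis
    using assms(1,2) by (auto simp: achieves_def max_def)
qed

text \<open>One query after each insertion suffices, since the optimal next item depends only on the
  used capacity and the items left.\<close>

lemma ex_achieves_opt:
  assumes "finite A" "B \<subseteq> A" "\<And>i. i \<in> A \<Longrightarrow> 0 \<le> v i"
  shows "\<exists>P. achieves v A m P (opt (\<lambda>i. ennreal (v i)) m B)"
  using assms
proof (induction m arbitrary: A B)
  case 0
  then show ?case using achieves_Stop[of v A 0] by (auto simp: opt.simps(1)[abs_def])
next
  case (Suc m)
  define F where "F i = step i (\<lambda>t. ennreal (v i) + opt (\<lambda>i. ennreal (v i)) m (B - {i}) t)" for i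
  have [measurable]: "F i \<in> borel_measurable borel" for i
    unfolding F_def by measurable
  have one: "\<exists>P. achieves v A (Suc m) P (F i)" if "i \<in> B" for i
  proof -
    obtain P where P: "achieves v (A - {i}) m P (opt (\<lambda>i. ennreal (v i)) m (B - {i}))"
      using Suc.IH[of "A - {i}" "B - {i}"] Suc.prems by blast
    then have "semi_adaptive (A - {i}) (Suc m) (Query P)"
      by (auto simp: achieves_def intro: semi_adaptive.intros)
    then have "achieves v A (Suc m) (\<lambda>_. Insert i (Query P)) (F i)"
      unfolding F_def using P Suc.prems that by (intro achieves_Insert) auto
    then show ?thesis by blast
  qed
  \<comment> \<open>The supremum over items is assembled from binary maxima; \<open>Stop\<close>
    realizes the empty supremum 0.\<close>
  have "\<exists>P. achieves v A (Suc m) P (\<lambda>s. SUP i\<in>C. F i s)" if "finite C" "C \<subseteq> B" for C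
    using that
  proof (induction C rule: finite_induct)
    case empty
    then show ?case using achieves_Stop[of v A "Suc m"] by (auto simp: bot_ennreal)
  next
    case (insert i C)
    obtain P where P: "achieves v A (Suc m) P (F i)" using one insert.prems by blast
    obtain Q where Q: "achieves v A (Suc m) Q (\<lambda>s. SUP i\<in>C. F i s)" using insert by blast
    have "(\<lambda>s. SUP i\<in>C. F i s) \<in> borel_measurable borel"
      using insert.hyps by (intro borel_measurable_SUP countable_finite) auto
    from achieves_max[OF P Q _ this] show ?case by (auto simp: sup_max)
  qed
  moreover have "finite B" using Suc.prems finite_subset by blast
  ultimately show ?case by (simp add: F_def opt.simps(2)[abs_def])
qed

lemma ex_achieves_list:
  assumes "finite A" "distinct l" "set l \<subseteq> A" "\<And>i. i \<in> A \<Longrightarrow> 0 \<le> v i"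
  shows "\<exists>p. achieves v A 0 (\<lambda>_. p) (list_value (\<lambda>i. ennreal (v i)) l)"
  using assms
proof (induction l arbitrary: A)
  case Nil
  then show ?case using achieves_Stop[of v A 0] by (auto simp: list_value.simps(1)[abs_def])
next
  case (Cons i l)
  obtain p where p: "achieves v (A - {i}) 0 (\<lambda>_. p) (list_value (\<lambda>i. ennreal (v i)) l)"
    using Cons.IH[of "A - {i}"] Cons.prems by auto
  then have "achieves v A 0 (\<lambda>_. Insert i p)
      (step i (\<lambda>t. ennreal (v i) + list_value (\<lambda>i. ennreal (v i)) l t))"
    using Cons.prems by (intro achieves_Insert[OF p]) (auto simp: achieves_def)
  then show ?case by (auto simp: list_value.simps(2)[abs_def])
qed

section \<open>Splitting the adaptive optimum into large and small items\<close>

text \<open>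
  Splits the optimum over \<open>A\<close> into the optima over the items inside and outside \<open>L\<close>: since \<open>opt\<close>
  decreases in the occupied capacity, inserting an item only hurts the other class. Working with
  \<open>opt\<close> avoids splitting the reward of \<open>p\<close> itself, whose two parts need not be measurable.
\<close>

lemma reward_le_opt:
  assumes "semi_adaptive A k p" "finite A" "\<And>i. i \<in> A \<Longrightarrow> 0 \<le> v i" "card A \<le> m"
    and "(\<lambda>X. reward v X p s) \<in> borel_measurable (PiM A M)"
  shows "(\<integral>\<^sup>+ X. ennreal (reward v X p s) \<partial>PiM A M)
    \<le> opt (\<lambda>i. ennreal (v i)) m (A \<inter> L) s + opt (\<lambda>i. ennreal (v i)) m (A - L) s"
  using assms
proof (induction arbitrary: m s rule: semi_adaptive.induct)
  case (1 A k)
  then show ?case by simp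
next
  \<comment> \<open>The capacity \<open>s\<close> is fixed at this point, so a query merely selects
    the subtree \<open>f s\<close>.\<close>
  case (3 A k f)
  then show ?case by simp
next
  case (2 i A k p)
  define V where "V = opt (\<lambda>i. ennreal (v i))"
  have "card A \<noteq> 0" using 2 by auto
  then obtain m0 where m: "m = Suc m0" using 2 by (cases m) auto
  have card: "card (A - {i}) \<le> m0" using 2 m by simp
  have ins: "insert i (A - {i}) = A" using 2 by auto
  have "(\<integral>\<^sup>+ X. ennreal (reward v X (Insert i p) s) \<partial>PiM A M)
    = (\<integral>\<^sup>+ y. (\<integral>\<^sup>+ X. ennreal (reward v (X(i := y)) (Insert i p) s) \<partial>PiM (A - {i}) M) \<partial>M i)"
    using product_nn_integral_insert_rev[of "A - {i}" i "\<lambda>X. ennreal (reward v X (Insert i p) s)", unfolded ins] 2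
    by (simp del: reward.simps)
  also have "\<dots> \<le> step i (\<lambda>t. ennreal (v i) + (V m0 ((A - {i}) \<inter> L) t + V m0 ((A - {i}) - L) t)) s"
    unfolding step_def
  proof (rule nn_integral_mono)
    fix y
    have "(\<integral>\<^sup>+ X. ennreal (reward v (X(i := y)) (Insert i p) s) \<partial>PiM (A - {i}) M)
      \<le> ennreal (v i) + (V m0 ((A - {i}) \<inter> L) (s + y) + V m0 ((A - {i}) - L) (s + y))"
      if y: "s + y \<le> 1"
    proof -
      have upd: "reward v (X(i := y)) p t = reward v X p t" for X t
        by (rule reward_cong[OF "2.hyps"(2)]) auto
      \<comment> \<open>Measurability is given for the whole policy only. Fixing coordinate
        \<open>i\<close> at a fitting size and subtracting \<open>v i\<close> recovers it for the
        subpolicy.\<close>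
      have "(\<lambda>X. X(i := y)) \<in> measurable (PiM (A - {i}) M) (PiM A M)"
        by (rule measurable_fun_upd[where J = "A - {i}"]) (use ins in auto)
      from measurable_compose[OF this "2.prems"(4)]
      have "(\<lambda>X. reward v (X(i := y)) (Insert i p) s - v i) \<in> borel_measurable (PiM (A - {i}) M)"
        by (rule borel_measurable_diff) simp
      then have m1: "(\<lambda>X. reward v X p (s + y)) \<in> borel_measurable (PiM (A - {i}) M)"
        using y by (simp add: upd)
      have "(\<integral>\<^sup>+ X. ennreal (reward v (X(i := y)) (Insert i p) s) \<partial>PiM (A - {i}) M)
        = (\<integral>\<^sup>+ X. ennreal (v i) + ennreal (reward v X p (s + y)) \<partial>PiM (A - {i}) M)"
      proof (rule nn_integral_cong)
        fix X
        have "0 \<le> reward v X p (s + y)"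
          by (rule reward_nonneg[OF "2.hyps"(2)]) (use "2.prems" in auto)
        then show "ennreal (reward v (X(i := y)) (Insert i p) s)
          = ennreal (v i) + ennreal (reward v X p (s + y))"
          using y "2.prems"(2)[OF "2.hyps"(1)] by (simp add: upd)
      qed
      also have "\<dots> = ennreal (v i) + (\<integral>\<^sup>+ X. ennreal (reward v X p (s + y)) \<partial>PiM (A - {i}) M)"
        using m1 by (subst nn_integral_add) auto
      also have "\<dots> \<le> ennreal (v i) + (V m0 ((A - {i}) \<inter> L) (s + y) + V m0 ((A - {i}) - L) (s + y))"
        unfolding V_def using "2.prems" card m1 by (intro add_left_mono "2.IH") auto
      finally show ?thesis .
    qed
    then show "(\<integral>\<^sup>+ X. ennreal (reward v (X(i := y)) (Insert i p) s) \<partial>PiM (A - {i}) M)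
      \<le> (if s + y \<le> 1 then ennreal (v i)
          + (V m0 ((A - {i}) \<inter> L) (s + y) + V m0 ((A - {i}) - L) (s + y)) else 0)"
      by simp
  qed
  also have "\<dots> \<le> V m (A \<inter> L) s + V m (A - L) s"
  proof -
    have split: "step i (\<lambda>t. ennreal (v i) + (V m0 (B - {i}) t + V m0 B' t)) s \<le> V m B s + V m B' s"
      if "i \<in> B" for B B'
    proof -
      have "step i (\<lambda>t. ennreal (v i) + (V m0 (B - {i}) t + V m0 B' t)) s
          = step i (\<lambda>t. ennreal (v i) + V m0 (B - {i}) t) s + step i (V m0 B') s"
        unfolding V_def by (subst step_add[symmetric]) (auto simp: add.assoc)
      also have "\<dots> \<le> V m B s + V m B' s"
      proof (rule add_mono)
        show "step i (\<lambda>t. ennreal (v i) + V m0 (B - {i}) t) s \<le> V m B s"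
          unfolding V_def m opt.simps by (rule SUP_upper[OF that])
        show "step i (V m0 B') s \<le> V m B' s"
        proof (rule step_le_bound)
          fix t assume "s \<le> t"
          then have "V m0 B' t \<le> V m0 B' s" unfolding V_def using antimonoD[OF antimono_opt] by blast
          also have "\<dots> \<le> V m B' s" unfolding V_def m by (rule opt_mono) auto
          finally show "V m0 B' t \<le> V m B' s" .
        qed
      qed
      finally show ?thesis .
    qed
    show ?thesis
    proof (cases "i \<in> L")
      case True
      then have "(A - {i}) \<inter> L = A \<inter> L - {i}" "(A - {i}) - L = A - L" by auto
      then show ?thesis using split[of "A \<inter> L" "A - L"] True 2 by simp
    next
      case False
      then have "(A - {i}) \<inter> L = A \<inter> L" "(A - {i}) - L = A - L - {i}" by auto
      then show ?thesis using split[of "A - L" "A \<inter> L"] False 2 by (simp add: add.commute)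
    qed
  qed
  finally show ?case unfolding V_def .
qed

text \<open>The constant 3 is 1 for the large items plus 2 for the small ones, both divided by
  \<open>1 - \<delta>\<close>. The number \<open>a\<close> stands for the optimum with
  \<open>k\<close> queries.\<close>

lemma reward_le_semi_adaptive:
  assumes A: "finite A" "\<And>i. i \<in> A \<Longrightarrow> 0 \<le> v i" and \<delta>: "0 \<le> \<delta>" "\<delta> < 1"
    and k: "exp 1 * (1 - \<delta> / 2) ^ k \<le> \<delta>"
    and p: "semi_adaptive A n p" "(\<lambda>X. reward v X p 0) \<in> borel_measurable (PiM A M)"
    and bound: "\<And>q. semi_adaptive A k q \<Longrightarrow> (\<lambda>X. reward v X q 0) \<in> borel_measurable (PiM A M) \<Longrightarrow>
      (\<integral>\<^sup>+ X. ennreal (reward v X q 0) \<partial>PiM A M) \<le> a"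
  shows "(\<integral>\<^sup>+ X. ennreal (reward v X p 0) \<partial>PiM A M) \<le> ennreal (3 / (1 - \<delta>)) * a"
proof -
  define u where "u = (\<lambda>i. ennreal (v i))"
  define L where "L = {i. ennreal \<delta> \<le> mean_size i}"
  define VL where "VL = opt u (card A) (A \<inter> L) 0"
  define VS where "VS = opt u (card A) (A - L) 0"
  have achieved: "f 0 \<le> a" if "achieves v A j P f" "j \<le> k" for P f j
    using bound[of "P 0"] measurable_achieves[OF that(1), of 0] that
    by (auto simp: achieves_def intro: semi_adaptive_mono)
  \<comment> \<open>The fresh optimum in the error term is taken to be \<open>VL\<close> itself, so
    that the error can be absorbed.\<close>
  have "VL \<le> opt u k (A \<inter> L) 0 + ennreal (exp (1 - 0) * (1 - \<delta> / 2) ^ k) * VL"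
    unfolding VL_def by (rule opt_le_truncated_opt) (use \<delta> in \<open>auto simp: L_def\<close>)
  also have "\<dots> \<le> a + ennreal \<delta> * VL"
  proof (intro add_mono mult_right_mono ennreal_leI)
    obtain P where "achieves v A k P (opt u k (A \<inter> L))"
      using ex_achieves_opt[of A "A \<inter> L" v k] A unfolding u_def by auto
    then show "opt u k (A \<inter> L) 0 \<le> a" using achieved by blast
  qed (use k in auto)
  finally have "VL \<le> a + ennreal \<delta> * VL" .
  moreover have "VL \<le> sum u (A \<inter> L)"
    unfolding VL_def by (rule order_trans[OF opt_le_opt_attempt opt_attempt_le_sum]) (simp add: A)
  then have "VL < \<top>" by (rule le_less_trans) (simp add: u_def A)
  ultimately have VL: "VL \<le> ennreal (1 / (1 - \<delta>)) * a" using \<delta> by (rule le_of_le_add_fraction)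
  obtain l where l: "distinct l" "set l = A - L" "greedy_bounds l (card A) (ennreal \<delta>) u"
    by (rule ex_greedy_list[of "A - L" "ennreal \<delta>"]) (use A in \<open>auto simp: L_def\<close>)
  define G where "G = list_attempt u l 0"
  have "VS \<le> opt_attempt u (card A) (A - L) 0"
    unfolding VS_def by (rule opt_le_opt_attempt)
  then have VS: "VS \<le> 2 * G" using l by (auto simp: greedy_bounds_def G_def)
  have "G \<le> list_value u l 0 + ennreal \<delta> * G" using l by (simp add: greedy_bounds_def G_def)
  moreover have "list_value u l 0 \<le> a"
  proof -
    obtain q where "achieves v A 0 (\<lambda>_. q) (list_value u l)"
      using ex_achieves_list[of A l v] A l unfolding u_def by auto
    then show ?thesis using achieved by blast
  qed
  ultimately have "G \<le> a + ennreal \<delta> * G" 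
    by (rule order_trans[OF _ add_right_mono])
  moreover have "G < \<top>"
    unfolding G_def
    by (rule le_less_trans[OF list_attempt_le_sum_list])
      (simp add: sum_list_distinct_conv_sum_set l(1) u_def)
  ultimately have G: "G \<le> ennreal (1 / (1 - \<delta>)) * a" using \<delta> by (rule le_of_le_add_fraction)
  have "(\<integral>\<^sup>+ X. ennreal (reward v X p 0) \<partial>PiM A M) \<le> VL + VS"
    unfolding VL_def VS_def u_def by (rule reward_le_opt[OF p(1) A _ p(2)]) auto
  also have "\<dots> \<le> ennreal (1 / (1 - \<delta>)) * a + 2 * (ennreal (1 / (1 - \<delta>)) * a)"
    by (intro add_mono VL order_trans[OF VS] mult_left_mono G) auto
  also have "\<dots> = (1 + 2) * (ennreal (1 / (1 - \<delta>)) * a)"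
    by (simp only: distrib_right mult_1)
  also have "\<dots> = 3 * ennreal (1 / (1 - \<delta>)) * a"
    by (simp add: mult.assoc)
  also have "3 * ennreal (1 / (1 - \<delta>)) = ennreal (3 / (1 - \<delta>))"
    using ennreal_mult'[of 3 "1 / (1 - \<delta>)"] by simp
  finally show ?thesis .
qed

end

section \<open>Transfer to instances and choice of the constants\<close>

lemma opt_adaptive_le:
  assumes I: "I \<in> knapsack_instances" and \<delta>: "0 \<le> \<delta>" "\<delta> < 1"
    and k: "exp 1 * (1 - \<delta> / 2) ^ k \<le> \<delta>"
  shows "opt_adaptive I \<le> ennreal (3 / (1 - \<delta>)) * opt_semi_adaptive k I"
proof -
  \<comment> \<open>Indices that are not items get a point mass at 0; the product over the actual
    items is unaffected.\<close>
  define M where "M i = (if i < num_items I then item_size I i else return borel 0)" for i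
  have item: "prob_space (item_size I i)" "sets (item_size I i) = sets borel"
    "AE x in item_size I i. 0 \<le> x" "0 \<le> item_value I i" if "i < num_items I" for i
    using I that by (simp_all add: knapsack_instances_def)
  interpret item_sizes M
  proof (rule item_sizes.intro)
    fix i
    show "prob_space (M i)"
      unfolding M_def by (simp add: item prob_space_return)
    show "sets (M i) = sets borel"
      unfolding M_def by (simp add: item)
    show "AE x in M i. 0 \<le> x"
      unfolding M_def by (simp add: item AE_return)
  qed
  have space: "size_space I = PiM {..<num_items I} M"
    unfolding size_space_def by (rule PiM_cong) (auto simp: M_def)
  show ?thesis
    unfolding opt_adaptive_def opt_semi_adaptive_def[of "num_items I"]
  proof (rule SUP_least)
    fix p assume p: "p \<in> policies I (num_items I)"
    then have p': "semi_adaptive {..<num_items I} (num_items I) p"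
        "(\<lambda>X. reward (item_value I) X p 0) \<in> borel_measurable (PiM {..<num_items I} M)"
      by (simp_all add: policies_def space)
    show "expected_value I p \<le> ennreal (3 / (1 - \<delta>)) * opt_semi_adaptive k I"
      unfolding expected_value_def space
    proof (rule reward_le_semi_adaptive[OF _ _ \<delta> k p'])
      fix q assume "semi_adaptive {..<num_items I} k q"
        "(\<lambda>X. reward (item_value I) X q 0) \<in> borel_measurable (PiM {..<num_items I} M)"
      then have "q \<in> policies I k" by (simp add: policies_def space)
      then have "expected_value I q \<le> opt_semi_adaptive k I"
        unfolding opt_semi_adaptive_def by (rule SUP_upper)
      then show "(\<integral>\<^sup>+ X. ennreal (reward (item_value I) X q 0) \<partial>PiM {..<num_items I} M)
        \<le> opt_semi_adaptive k I"
        by (simp add: expected_value_def space)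
    qed (simp_all add: item)
  qed
qed

lemma ennreal_divide_le_of_le_mult:
  fixes a b c :: ennreal
  assumes "a \<le> c * b" "c < \<top>"
  shows "a / b \<le> c"
proof (cases "b = 0 \<or> b = \<top>")
  \<comment> \<open>If \<open>b = 0\<close> then \<open>a = 0\<close> and the quotient is 0 / 0 = 0;
    if \<open>b\<close> is infinite the quotient is 0.\<close>
  case True
  then show ?thesis using assms by auto
next
  case False
  then have "a / b \<le> c * b / b" using assms by (intro divide_right_mono_ennreal)
  then show ?thesis using False by (simp add: ennreal_mult_divide_eq)
qed

theorem mainTheorem3:
  "\<exists>(C::real) (d::nat). 0 < C \<and>
     (\<forall>\<epsilon>::real. 0 < \<epsilon> \<longrightarrow> \<epsilon> < 1 \<longrightarrow>
       (\<exists>k::nat. real k \<le> C * (1 / \<epsilon>) * (1 + ln (1 / \<epsilon>)) ^ d \<and>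
                 semi_adaptivity_gap k \<le> ennreal (3 + C * \<epsilon>)))"
\<comment> \<open>In the bound on \<open>k\<close>, 9 = 4 * 2 + 1: the 2 comes from replacing
  \<open>ln (2 / \<epsilon>)\<close> by \<open>ln (1 / \<epsilon>)\<close>, the 1 from rounding
  up.\<close>
proof (rule exI[of _ 9], rule exI[of _ 1], intro conjI allI impI)
  fix \<epsilon> :: real assume \<epsilon>: "0 < \<epsilon>" "\<epsilon> < 1"
  define \<delta> where "\<delta> = \<epsilon> / 2"
  \<comment> \<open>Here \<open>4 / \<epsilon> = 2 / \<delta>\<close> and
    \<open>2 / \<epsilon> = 1 / \<delta>\<close>, so \<open>exp (- (\<delta> / 2 * real k))\<close>
    is at most \<open>\<delta> / exp 1\<close>; the summand 1 cancels the Chernoff prefactor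
    \<open>exp 1\<close>.\<close>
  define k where "k = nat \<lceil>4 / \<epsilon> * (1 + ln (2 / \<epsilon>))\<rceil>"
  have \<delta>: "0 < \<delta>" "\<delta> < 1 / 2" using \<epsilon> by (auto simp: \<delta>_def)
  have ln: "0 \<le> ln (1 / \<epsilon>)" using \<epsilon> by simp
  have ln2: "ln (2 / \<epsilon>) \<le> 1 + ln (1 / \<epsilon>)"
    using \<epsilon> ln_le_minus_one[of 2] by (simp add: ln_div)
  have pos: "0 \<le> 4 / \<epsilon> * (1 + ln (2 / \<epsilon>))" using \<epsilon> by simp
  have k_ge: "4 / \<epsilon> * (1 + ln (2 / \<epsilon>)) \<le> real k" unfolding k_def by linarith
  have "real k \<le> 4 / \<epsilon> * (1 + ln (2 / \<epsilon>)) + 1" unfolding k_def using pos by linarith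
  also have "\<dots> \<le> 4 / \<epsilon> * (2 * (1 + ln (1 / \<epsilon>))) + 1 / \<epsilon> * (1 + ln (1 / \<epsilon>))"
  proof (rule add_mono)
    show "4 / \<epsilon> * (1 + ln (2 / \<epsilon>)) \<le> 4 / \<epsilon> * (2 * (1 + ln (1 / \<epsilon>)))"
    proof (rule mult_left_mono)
      have "1 + ln (2 / \<epsilon>) \<le> (1 + ln (1 / \<epsilon>)) + (1 + ln (1 / \<epsilon>))"
        by (rule add_mono) (use ln2 ln in simp_all)
      then show "1 + ln (2 / \<epsilon>) \<le> 2 * (1 + ln (1 / \<epsilon>))" by (simp only: mult_2)
    qed (use \<epsilon> in simp)
    have "1 * 1 \<le> 1 / \<epsilon> * (1 + ln (1 / \<epsilon>))"
      by (rule mult_mono) (use \<epsilon> ln in simp_all)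
    then show "1 \<le> 1 / \<epsilon> * (1 + ln (1 / \<epsilon>))" by (simp only: mult_1)
  qed
  also have "\<dots> = 9 * (1 / \<epsilon>) * (1 + ln (1 / \<epsilon>)) ^ 1"
    by (simp add: add_divide_distrib[symmetric] distrib_left)
  finally have k_le: "real k \<le> 9 * (1 / \<epsilon>) * (1 + ln (1 / \<epsilon>)) ^ 1" .
  show "\<exists>k::nat. real k \<le> 9 * (1 / \<epsilon>) * (1 + ln (1 / \<epsilon>)) ^ 1 \<and>
      semi_adaptivity_gap k \<le> ennreal (3 + 9 * \<epsilon>)"
  proof (intro exI[of _ k] conjI k_le)
    have "(1 - \<delta> / 2) ^ k \<le> exp (- (\<delta> / 2)) ^ k"
      using \<delta> exp_ge_add_one_self[of "- (\<delta> / 2)"] by (intro power_mono) auto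
    also have "\<dots> = exp (- (\<delta> / 2 * real k))" by (simp add: exp_of_nat_mult[symmetric] mult.commute)
    also have "\<dots> \<le> exp (- (1 + ln (2 / \<epsilon>)))"
    proof -
      have "\<delta> / 2 * (4 / \<epsilon> * (1 + ln (2 / \<epsilon>))) \<le> \<delta> / 2 * real k"
        using \<delta> k_ge by (intro mult_left_mono) auto
      then show ?thesis using \<epsilon> by (simp add: \<delta>_def)
    qed
    also have "\<dots> = exp (- 1) * \<delta>"
      using \<epsilon> by (simp add: \<delta>_def exp_diff exp_minus exp_add field_simps)
    finally have "exp 1 * (1 - \<delta> / 2) ^ k \<le> exp 1 * (exp (- 1) * \<delta>)" by (rule mult_left_mono) simp
    also have "\<dots> = exp (1 + - 1) * \<delta>" by (simp only: exp_add mult.assoc)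
    finally have k: "exp 1 * (1 - \<delta> / 2) ^ k \<le> \<delta>" by simp
    have "3 / (1 - \<delta>) \<le> 3 + 9 * \<epsilon>"
    proof -
      \<comment> \<open>With \<open>9 * \<epsilon> = 18 * \<delta>\<close>, the product
        \<open>(3 + 18 * \<delta>) * (1 - \<delta>)\<close> exceeds 3 by
        \<open>3 * \<delta> * (5 - 6 * \<delta>)\<close>.\<close>
      have "0 \<le> \<delta> * (5 - 6 * \<delta>)" using \<delta> by (intro mult_nonneg_nonneg) auto
      then have "3 \<le> (3 + 9 * \<epsilon>) * (1 - \<delta>)"
        using \<delta> \<epsilon> by (simp add: \<delta>_def algebra_simps)
      then show ?thesis using \<delta> by (simp add: pos_divide_le_eq)
    qed
    then have C: "ennreal (3 / (1 - \<delta>)) \<le> ennreal (3 + 9 * \<epsilon>)" by (rule ennreal_leI)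
    show "semi_adaptivity_gap k \<le> ennreal (3 + 9 * \<epsilon>)"
      unfolding semi_adaptivity_gap_def
    proof (rule SUP_least)
      fix I assume "I \<in> knapsack_instances"
      then have "opt_adaptive I \<le> ennreal (3 / (1 - \<delta>)) * opt_semi_adaptive k I"
        using \<delta> k by (intro opt_adaptive_le) auto
      then have "opt_adaptive I / opt_semi_adaptive k I \<le> ennreal (3 / (1 - \<delta>))"
        by (rule ennreal_divide_le_of_le_mult) simp
      then show "opt_adaptive I / opt_semi_adaptive k I \<le> ennreal (3 + 9 * \<epsilon>)"
        using C by (rule order_trans)
    qed
  qed
qed simp

end
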